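(* Let $n\ge 3$ be odd. One has $d\mathcal{A}=i_\eta\omega$, where $\mathcal{A}$ is the algebraic multi-area function on plane $n$-gons and $\eta=\sum_{i=1}^n (x_i\,\partial_{y_i}-y_i\,\partial_{x_i})$ is the rotation vector field acting on polygons diagonally.
   Context: A plane $n$-gon is an $n$-tuple $\mathbf{P}=(P_1,\dots,P_n)$ of points $P_i=(x_i,y_i)\in\mathbb{R}^2$. Define $$\omega=\sum_{1\le i<j\le n}(-1)^{i+j-1}(dx_i\wedge dx_j+dy_i\wedge dy_j),\qquad \mathcal{A}(\mathbf{P})=\sum_{1\le i<j\le n}(-1)^{i+j-1}\det(P_i,P_j),$$ where $\det(P_i,P_j)=x_iy_j-y_ix_j$, and $i_\eta\omega=\omega(\eta,\cdot)$. *)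

theory Defs
  imports "HOL-Analysis.Analysis"
begin

text \<open>
  A plane \<open>n\<close>-gon is an element of \<open>(\<real>\<^sup>2)\<^sup>n\<close>, where \<open>n = CARD('n)\<close> for a finite linearly ordered
  index type \<open>'n\<close>; the linear order is the order of the vertices. The element \<open>i\<close> of \<open>'n\<close> carries
  the 1-based number \<open>pos i\<close>, so that \<open>pos\<close> is the order isomorphism from \<open>'n\<close> to \<open>{1..n}\<close>.
\<close>

type_synonym 'n polygon = "real ^ 2 ^ 'n"

definition pos :: "'n::{finite,linorder} \<Rightarrow> nat" where
  "pos i = card {..i}"

lemma pos_less_iff: "pos i < pos j \<longleftrightarrow> i < j"
proof -
  have *: "pos a < pos b" if "a < b" for a b :: 'a
    unfolding pos_def using that by (intro psubset_card_mono) auto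
  show ?thesis using *[of i j] *[of j i] by (cases i j rule: linorder_cases) auto
qed

lemma bij_betw_pos: "bij_betw pos (UNIV :: 'n::{finite,linorder} set) {1..CARD('n)}"
proof -
  have inj: "inj (pos :: 'n \<Rightarrow> nat)"
    by (rule injI) (metis pos_less_iff less_irrefl linorder_less_linear)
  have sub: "range (pos :: 'n \<Rightarrow> nat) \<subseteq> {1..CARD('n)}"
    by (auto simp: pos_def Suc_le_eq card_gt_0_iff intro!: card_mono)
  have "range (pos :: 'n \<Rightarrow> nat) = {1..CARD('n)}"
    using sub by (rule card_subset_eq[rotated]) (simp_all add: card_image inj)
  with inj show ?thesis by (simp add: bij_betw_def)
qed

definition xc :: "'n::finite \<Rightarrow> 'n polygon \<Rightarrow> real" where
  "xc i P = P $ i $ 1"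

definition yc :: "'n::finite \<Rightarrow> 'n polygon \<Rightarrow> real" where
  "yc i P = P $ i $ 2"

text \<open>
  Every tangent space of a normed space \<open>'a\<close> is identified with \<open>'a\<close>: a vector field is a map
  \<open>'a \<Rightarrow> 'a\<close>, a 1-form a map \<open>'a \<Rightarrow> 'a \<Rightarrow> real\<close> and a 2-form a map \<open>'a \<Rightarrow> 'a \<Rightarrow> 'a \<Rightarrow> real\<close>, whose
  first argument is the base point.
\<close>

text \<open>Since \<^const>\<open>frechet_derivative\<close> is a choice operator, \<open>differential f\<close> is meaningful only
  where \<open>f\<close> is differentiable.\<close>

definition differential :: "('a::real_normed_vector \<Rightarrow> real) \<Rightarrow> 'a \<Rightarrow> 'a \<Rightarrow> real" where
  "differential f p = frechet_derivative f (at p)"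

definition wedge :: "('a \<Rightarrow> 'a \<Rightarrow> real) \<Rightarrow> ('a \<Rightarrow> 'a \<Rightarrow> real) \<Rightarrow> 'a \<Rightarrow> 'a \<Rightarrow> 'a \<Rightarrow> real" where
  "wedge \<alpha> \<beta> p u v = \<alpha> p u * \<beta> p v - \<alpha> p v * \<beta> p u"

definition interior_product ::
    "('a \<Rightarrow> 'a) \<Rightarrow> ('a \<Rightarrow> 'a \<Rightarrow> 'a \<Rightarrow> real) \<Rightarrow> 'a \<Rightarrow> 'a \<Rightarrow> real" where
  "interior_product X \<theta> p v = \<theta> p (X p) v"

definition dx :: "'n::finite \<Rightarrow> 'n polygon \<Rightarrow> 'n polygon \<Rightarrow> real" where
  "dx i = differential (xc i)"

definition dy :: "'n::finite \<Rightarrow> 'n polygon \<Rightarrow> 'n polygon \<Rightarrow> real" where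
  "dy i = differential (yc i)"

definition partial_x :: "'n::finite \<Rightarrow> 'n polygon \<Rightarrow> 'n polygon" where
  "partial_x i P = axis i (axis 1 1)"

definition partial_y :: "'n::finite \<Rightarrow> 'n polygon \<Rightarrow> 'n polygon" where
  "partial_y i P = axis i (axis 2 1)"

definition omega ::
    "'n::{finite,linorder} polygon \<Rightarrow> 'n polygon \<Rightarrow> 'n polygon \<Rightarrow> real" where
  "omega P u v = (\<Sum>(i, j) \<in> {(i, j). i < j}.
     (-1) ^ (pos i + pos j - 1) * (wedge (dx i) (dx j) P u v + wedge (dy i) (dy j) P u v))"

definition det2 :: "real ^ 2 \<Rightarrow> real ^ 2 \<Rightarrow> real" where
  "det2 p q = p $ 1 * q $ 2 - p $ 2 * q $ 1"

definition multi_area :: "'n::{finite,linorder} polygon \<Rightarrow> real" where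
  "multi_area P = (\<Sum>(i, j) \<in> {(i, j). i < j}. (-1) ^ (pos i + pos j - 1) * det2 (P $ i) (P $ j))"

definition rotation_field :: "'n::finite polygon \<Rightarrow> 'n polygon" where
  "rotation_field P = (\<Sum>i\<in>UNIV. xc i P *\<^sub>R partial_y i P - yc i P *\<^sub>R partial_x i P)"

end

theory Submission imports Defs begin

text \<open>Since \<open>\<eta>(x\<^sub>i) = - y\<^sub>i\<close> and \<open>\<eta>(y\<^sub>i) = x\<^sub>i\<close>, contracting \<open>dx\<^sub>i \<and> dx\<^sub>j + dy\<^sub>i \<and> dy\<^sub>j\<close> with \<open>\<eta>\<close> gives
  \<open>y\<^sub>j dx\<^sub>i - y\<^sub>i dx\<^sub>j + x\<^sub>i dy\<^sub>j - x\<^sub>j dy\<^sub>i = d(x\<^sub>i y\<^sub>j - y\<^sub>i x\<^sub>j)\<close>, so the identity holds for each pair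
  \<open>i < j\<close> separately, whatever the signs.\<close>

text \<open>Uniqueness of the Frechet derivative pins down the value of the choice operator.\<close>

lemma differential_eq:
  assumes "(f has_derivative f') (at p)"
  shows "differential f p = f'"
  unfolding differential_def using frechet_derivative_at[OF assms] by simp

lemma has_derivative_nth_nth:
  "((\<lambda>v. v $ i $ k) has_derivative (\<lambda>v. v $ i $ k)) (at (P :: 'n::finite polygon))"
  by (intro bounded_linear_imp_has_derivative bounded_linear_compose[OF bounded_linear_vec_nth]
      bounded_linear_vec_nth)

lemma dx_eq: "dx i P v = v $ i $ 1"
proof -
  have "(xc i has_derivative (\<lambda>v. v $ i $ 1)) (at P)"
    unfolding xc_def[abs_def] by (rule has_derivative_nth_nth)
  then show ?thesis by (simp add: dx_def differential_eq)
qed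

lemma dy_eq: "dy i P v = v $ i $ 2"
proof -
  have "(yc i has_derivative (\<lambda>v. v $ i $ 2)) (at P)"
    unfolding yc_def[abs_def] by (rule has_derivative_nth_nth)
  then show ?thesis by (simp add: dy_def differential_eq)
qed

lemma rotation_field_nth:
  "rotation_field P $ i $ 1 = - (P $ i $ 2)"
  "rotation_field P $ i $ 2 = P $ i $ 1"
proof -
  \<comment> \<open>Coordinate vectors based at other vertices vanish at \<open>i\<close>; the
    \<open>if\<close> form lets the sum collapse.\<close>
  have "rotation_field P $ i = (\<Sum>k\<in>UNIV. if k = i then xc i P *\<^sub>R axis 2 1 - yc i P *\<^sub>R axis 1 1 else 0)"
    unfolding rotation_field_def sum_component
    by (rule sum.cong) (auto simp: partial_x_def partial_y_def axis_def)
  then have "rotation_field P $ i = xc i P *\<^sub>R axis 2 1 - yc i P *\<^sub>R axis 1 1"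
    by simp
  then show "rotation_field P $ i $ 1 = - (P $ i $ 2)" "rotation_field P $ i $ 2 = P $ i $ 1"
    by (simp_all add: xc_def yc_def axis_def)
qed

lemma has_derivative_det2_nth:
  "((\<lambda>P. det2 (P $ i) (P $ j)) has_derivative
     (\<lambda>v. wedge (dx i) (dx j) P (rotation_field P) v + wedge (dy i) (dy j) P (rotation_field P) v)) (at P)"
  unfolding det2_def wedge_def dx_eq dy_eq rotation_field_nth
  by (auto intro!: derivative_eq_intros has_derivative_nth_nth simp: algebra_simps)

lemma has_derivative_multi_area:
  "(multi_area has_derivative interior_product rotation_field omega P) (at P)"
  \<comment> \<open>The signs are constant factors, so linearity reduces the claim to single
    pairs.\<close>
  unfolding multi_area_def[abs_def] interior_product_def[abs_def] omega_def case_prod_unfold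
  by (intro has_derivative_sum has_derivative_mult_right has_derivative_det2_nth)

theorem lemma3p3:
  assumes "CARD('n::{finite,linorder}) \<ge> 3" and "odd (CARD('n))"
  shows "(\<forall>P :: 'n polygon. multi_area differentiable (at P)) \<and>
         differential (multi_area :: 'n polygon \<Rightarrow> real) = interior_product rotation_field omega"
  \<comment> \<open>One derivative fact yields both differentiability and, at each base point,
    equality of the 1-forms.\<close>
  using has_derivative_multi_area by (blast intro: differentiableI differential_eq)

end
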